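(* Let $n\geq1$. For each integer $\ell\geq1$ let $\omega_\ell\geq0$ be the number such that $\omega\mapsto k_\ell(\omega)/\omega$ is an analytic, increasing bijection from $(\omega_\ell,+\infty)$ onto $(1/C_\infty,1/C_0)$. Then, for all $\ell\geq1$, $$\frac1{C_0}=\sup_{\omega>\omega_\ell}\frac{k_\ell(\omega)}{\omega}=\lim_{\omega\to+\infty}\frac{k_\ell(\omega)}{\omega}\qquad\text{and}\qquad \frac1{C_\infty}=\inf_{\omega>\omega_\ell}\frac{k_\ell(\omega)}{\omega}=\lim_{\omega\to\omega_\ell}\frac{k_\ell(\omega)}{\omega},$$ the last limit being taken over $\omega>\omega_\ell$.
   Context: Medium. Let $n\geq1$ be an integer, $0=H_1<H_2<\dots<H_{n+1}<H_{n+2}=+\infty$, $T_j=H_{j+1}-H_j\in(0,+\infty]$, and $\mu_j,\rho_j>0$ for $1\leq j\leq n+1$. Put $C_j=\sqrt{\mu_j/\rho_j}$, $C_0=\min_{1\leq j\leq n+1}C_j$, $C_\infty=C_{n+1}$. Standing assumption: $C_0<C_\infty$ (no monotonicity of the $C_j$ is assumed). Dispersion function. For $\omega>0$ and real $k$, let $\nu_j=\nu_j(\omega,k)=\omega\sqrt{k^2\omega^{-2}-C_j^{-2}}$, where the square root of a nonnegative number is the nonnegative one and $\sqrt{-a}=-i\sqrt a$ for $a>0$. Define $P_0=1$, $Q_0=0$ and, for $1\leq m\leq n$, $\begin{pmatrix}P_m\\Q_m\end{pmatrix}=M_m\begin{pmatrix}P_{m-1}\\Q_{m-1}\end{pmatrix}$,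 where $M_m=\begin{pmatrix}\cosh(\nu_mT_m)&\sinh(\nu_mT_m)/(\mu_m\nu_m)\\ \mu_m\nu_m\sinh(\nu_mT_m)&\cosh(\nu_mT_m)\end{pmatrix}$ if $\nu_m\neq0$ and $M_m=\begin{pmatrix}1&T_m/\mu_m\\0&1\end{pmatrix}$ if $\nu_m=0$. Set $f_n(\omega,k)=\mu_{n+1}\nu_{n+1}P_n+Q_n$. Branches. For $\omega>0$, $k_1(\omega)>k_2(\omega)>\cdots$ denote, in decreasing order, the (finitely many) values $k\in[\omega/C_\infty,\omega/C_0)$ with $f_n(\omega,k)=0$; $k_\ell(\omega)$ is undefined if there are fewer than $\ell$ such values. The paper states that, for every $n\geq1$ and every $\ell\geq1$, a number $\omega_\ell$ as in the claim exists; the present statement is an immediate consequence of that result. *)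

theory Defs
  imports "HOL-Analysis.Analysis"
begin

text \<open>
  A layered medium is given by \<open>n :: nat\<close>, interfaces \<open>H :: nat \<Rightarrow> ereal\<close> and coefficients
  \<open>\<mu>, \<rho> :: nat \<Rightarrow> real\<close>. Only the indices \<open>1, \<dots>, n + 2\<close> of \<open>H\<close> and \<open>1, \<dots>, n + 1\<close> of
  \<open>\<mu>\<close>, \<open>\<rho>\<close> are meaningful; layer \<open>n + 1\<close> is the half-space.
\<close>

definition thickness :: "(nat \<Rightarrow> ereal) \<Rightarrow> nat \<Rightarrow> ereal" where
  "thickness H j = H (j + 1) - H j"

definition speed :: "(nat \<Rightarrow> real) \<Rightarrow> (nat \<Rightarrow> real) \<Rightarrow> nat \<Rightarrow> real" where
  "speed \<mu> \<rho> j = sqrt (\<mu> j / \<rho> j)"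

definition speed_min :: "nat \<Rightarrow> (nat \<Rightarrow> real) \<Rightarrow> (nat \<Rightarrow> real) \<Rightarrow> real" where
  "speed_min n \<mu> \<rho> = Min (speed \<mu> \<rho> ` {1..n + 1})"

definition speed_inf :: "nat \<Rightarrow> (nat \<Rightarrow> real) \<Rightarrow> (nat \<Rightarrow> real) \<Rightarrow> real" where
  "speed_inf n \<mu> \<rho> = speed \<mu> \<rho> (n + 1)"

text \<open>The branch of the square root with \<open>\<surd>(-a) = -\<i> \<surd>a\<close> for \<open>a > 0\<close>, unlike \<^const>\<open>csqrt\<close>.\<close>

definition sqrt_neg_im :: "real \<Rightarrow> complex" where
  "sqrt_neg_im x = (if x \<ge> 0 then complex_of_real (sqrt x) else - \<i> * complex_of_real (sqrt (- x)))"

definition nu :: "(nat \<Rightarrow> real) \<Rightarrow> (nat \<Rightarrow> real) \<Rightarrow> nat \<Rightarrow> real \<Rightarrow> real \<Rightarrow> complex" where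
  "nu \<mu> \<rho> j \<omega> k =
     complex_of_real \<omega> * sqrt_neg_im (k\<^sup>2 * (inverse \<omega>)\<^sup>2 - (inverse (speed \<mu> \<rho> j))\<^sup>2)"

text \<open>
  The transfer matrix is used for layers \<open>1 \<le> m \<le> n\<close> only, where the thickness is finite, so that
  \<^const>\<open>real_of_ereal\<close> loses nothing.
\<close>

definition transfer_matrix ::
  "(nat \<Rightarrow> ereal) \<Rightarrow> (nat \<Rightarrow> real) \<Rightarrow> (nat \<Rightarrow> real) \<Rightarrow> nat \<Rightarrow> real \<Rightarrow> real \<Rightarrow> complex^2^2" where
  "transfer_matrix H \<mu> \<rho> m \<omega> k =
    (let \<nu> = nu \<mu> \<rho> m \<omega> k;
         T = complex_of_real (real_of_ereal (thickness H m));
         \<mu>\<^sub>m = complex_of_real (\<mu> m)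
     in if \<nu> \<noteq> 0
        then vector [vector [cosh (\<nu> * T), sinh (\<nu> * T) / (\<mu>\<^sub>m * \<nu>)],
                     vector [\<mu>\<^sub>m * \<nu> * sinh (\<nu> * T), cosh (\<nu> * T)]]
        else vector [vector [1, T / \<mu>\<^sub>m],
                     vector [0, 1]])"

text \<open>The components of \<open>PQ H \<mu> \<rho> \<omega> k m\<close> are \<open>P\<^sub>m\<close> and \<open>Q\<^sub>m\<close>.\<close>

primrec PQ ::
  "(nat \<Rightarrow> ereal) \<Rightarrow> (nat \<Rightarrow> real) \<Rightarrow> (nat \<Rightarrow> real) \<Rightarrow> real \<Rightarrow> real \<Rightarrow> nat \<Rightarrow> complex^2" where
  "PQ H \<mu> \<rho> \<omega> k 0 = vector [1, 0]"
| "PQ H \<mu> \<rho> \<omega> k (Suc m) = transfer_matrix H \<mu> \<rho> (Suc m) \<omega> k *v PQ H \<mu> \<rho> \<omega> k m"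

definition dispersion ::
  "nat \<Rightarrow> (nat \<Rightarrow> ereal) \<Rightarrow> (nat \<Rightarrow> real) \<Rightarrow> (nat \<Rightarrow> real) \<Rightarrow> real \<Rightarrow> real \<Rightarrow> complex" where
  "dispersion n H \<mu> \<rho> \<omega> k =
     complex_of_real (\<mu> (n + 1)) * nu \<mu> \<rho> (n + 1) \<omega> k * PQ H \<mu> \<rho> \<omega> k n $ 1
       + PQ H \<mu> \<rho> \<omega> k n $ 2"

definition wavenumbers ::
  "nat \<Rightarrow> (nat \<Rightarrow> ereal) \<Rightarrow> (nat \<Rightarrow> real) \<Rightarrow> (nat \<Rightarrow> real) \<Rightarrow> real \<Rightarrow> real set" where
  "wavenumbers n H \<mu> \<rho> \<omega> =
     {k. \<omega> / speed_inf n \<mu> \<rho> \<le> k \<and> k < \<omega> / speed_min n \<mu> \<rho> \<and> dispersion n H \<mu> \<rho> \<omega> k = 0}"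

text \<open>
  The \<open>\<ell>\<close>-th largest wavenumber, counting from \<open>\<ell> = 1\<close>; \<^const>\<open>None\<close> means undefined.
\<close>

definition branch ::
  "nat \<Rightarrow> (nat \<Rightarrow> ereal) \<Rightarrow> (nat \<Rightarrow> real) \<Rightarrow> (nat \<Rightarrow> real) \<Rightarrow> nat \<Rightarrow> real \<Rightarrow> real option" where
  "branch n H \<mu> \<rho> l \<omega> =
     (let K = wavenumbers n H \<mu> \<rho> \<omega>
      in if finite K \<and> 1 \<le> l \<and> l \<le> card K
         then Some (rev (sorted_list_of_set K) ! (l - 1))
         else None)"

text \<open>The function \<open>\<omega> \<mapsto> k\<^sub>\<ell>(\<omega>) / \<omega>\<close>; meaningful only where the branch is defined.\<close>

definition slowness ::
  "nat \<Rightarrow> (nat \<Rightarrow> ereal) \<Rightarrow> (nat \<Rightarrow> real) \<Rightarrow> (nat \<Rightarrow> real) \<Rightarrow> nat \<Rightarrow> real \<Rightarrow> real" where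
  "slowness n H \<mu> \<rho> l \<omega> = the (branch n H \<mu> \<rho> l \<omega>) / \<omega>"

text \<open>
  Real analyticity: near each point of \<open>S\<close> the function is the sum of a power series
  with positive radius of convergence (\<^const>\<open>analytic_on\<close> is for complex functions only).
\<close>

definition real_analytic_on :: "(real \<Rightarrow> real) \<Rightarrow> real set \<Rightarrow> bool" where
  "real_analytic_on f S \<longleftrightarrow> (\<forall>x\<in>S. \<exists>F. (\<lambda>h. f (x + h)) has_fps_expansion F)"

end

theory Submission
  imports Defs
begin

text \<open>
  Let \<open>s\<close> be the slowness of the \<open>\<ell>\<close>-th branch and \<open>I\<close> the open interval
  \<open>(1 / C\<^sub>\<infinity>, 1 / C\<^sub>0)\<close>. Supremum and infimum of \<open>s\<close> depend only on its
  range, which is \<open>I\<close>, so they are the end points of \<open>I\<close>. The limits come from monotonicity and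
  surjectivity together: for every level \<open>y < 1 / C\<^sub>0\<close> the function attains a value
  above \<open>y\<close>, and, being increasing, stays above \<open>y\<close> from there on, while it never reaches
  \<open>1 / C\<^sub>0\<close>; hence \<open>s\<close> tends to \<open>1 / C\<^sub>0\<close>
  (\<open>tendsto_at_top_if_mono_onto_interval\<close>). The limit at
  \<open>\<omega>\<^sub>\<ell>\<close> is the mirror image
  (\<open>tendsto_at_right_if_mono_onto_interval\<close>).
\<close>

lemma less_if_ray_onto_interval:
  fixes f :: "'a::{linorder, no_top} \<Rightarrow> 'b::order"
  assumes "f ` {c<..} = {a<..<b}"
  shows "a < b"
proof -
  obtain x where "c < x" using gt_ex by blast
  then have "f x \<in> {a<..<b}" using assms by auto
  then show ?thesis by (meson greaterThanLessThan_iff less_trans)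
qed

text \<open>
  A point where \<open>f\<close> exceeds a given level below \<open>b\<close> serves as threshold for all later points,
  by monotonicity. Such a point exists because the range comes arbitrarily close to \<open>b\<close>.
\<close>

lemma tendsto_at_top_if_mono_onto_interval:
  fixes f :: "'a::{linorder, no_top} \<Rightarrow> 'b::{linorder_topology, dense_order}"
  assumes mono: "mono_on {c<..} f" and onto: "f ` {c<..} = {a<..<b}"
  shows "(f \<longlongrightarrow> b) at_top"
proof (rule order_tendstoI)
  fix y assume "y < b"
  have "a < b"
    by (rule less_if_ray_onto_interval[OF onto])
  then obtain z where "max a y < z" "z < b"
    using \<open>y < b\<close> dense[of "max a y" b] by auto
  then obtain x where x: "c < x" "y < f x"
    using onto by (metis (no_types, lifting) greaterThanLessThan_iff greaterThan_iff imageE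
        max_less_iff_conj)
  show "\<forall>\<^sub>F w in at_top. y < f w"
    using eventually_ge_at_top[of x]
  proof eventually_elim
    case (elim w)
    then have "f x \<le> f w"
      using x(1) by (intro mono_onD[OF mono]) auto
    with x(2) show ?case by simp
  qed
next
  fix y assume "b < y"
  show "\<forall>\<^sub>F w in at_top. f w < y"
    using eventually_gt_at_top[of c]
  proof eventually_elim
    case (elim w)
    then have "f w < b" using onto by auto
    with \<open>b < y\<close> show ?case by simp
  qed
qed

text \<open>
  Here the threshold is a point where \<open>f\<close> is below a given level above \<open>a\<close>; it bounds a right
  neighbourhood of \<open>c\<close> because \<open>c\<close> itself lies outside the domain ray.
\<close>

lemma tendsto_at_right_if_mono_onto_interval:
  fixes f :: "'a::{linorder_topology, no_top} \<Rightarrow> 'b::{linorder_topology, dense_order}"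
  assumes mono: "mono_on {c<..} f" and onto: "f ` {c<..} = {a<..<b}"
  shows "(f \<longlongrightarrow> a) (at_right c)"
proof (rule order_tendstoI)
  fix y assume "a < y"
  have "a < b"
    by (rule less_if_ray_onto_interval[OF onto])
  then obtain z where "a < z" "z < min b y"
    using \<open>a < y\<close> dense[of a "min b y"] by auto
  then obtain x where x: "c < x" "f x < y"
    using onto by (metis (no_types, lifting) greaterThanLessThan_iff greaterThan_iff imageE
        min_less_iff_conj)
  show "\<forall>\<^sub>F w in at_right c. f w < y"
  proof (rule eventually_at_rightI[OF _ x(1)])
    fix w assume "w \<in> {c<..<x}"
    then have "f w \<le> f x"
      using x(1) by (intro mono_onD[OF mono]) auto
    with x(2) show "f w < y" by simp
  qed
next
  fix y assume "y < a"
  obtain x where "c < x" using gt_ex by blast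
  then show "\<forall>\<^sub>F w in at_right c. y < f w"
  proof (rule eventually_at_rightI[rotated])
    fix w assume "w \<in> {c<..<x}"
    then have "a < f w" using onto by auto
    with \<open>y < a\<close> show "y < f w" by simp
  qed
qed

theorem corollary1p2:
  fixes n :: nat and H :: "nat \<Rightarrow> ereal" and \<mu> \<rho> :: "nat \<Rightarrow> real" and \<omega>\<^sub>c :: "nat \<Rightarrow> real"
  assumes "n \<ge> 1"
    and "H 1 = 0" and "H (n + 2) = \<infinity>"
    and "\<And>j. j \<in> {1..n + 1} \<Longrightarrow> H j < H (j + 1)"
    and "\<And>j. j \<in> {1..n + 1} \<Longrightarrow> \<mu> j > 0"
    and "\<And>j. j \<in> {1..n + 1} \<Longrightarrow> \<rho> j > 0"
    and "speed_min n \<mu> \<rho> < speed_inf n \<mu> \<rho>"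
    and "\<And>l. l \<ge> 1 \<Longrightarrow> \<omega>\<^sub>c l \<ge> 0"
    and "\<And>l \<omega>. l \<ge> 1 \<Longrightarrow> \<omega> > \<omega>\<^sub>c l \<Longrightarrow> branch n H \<mu> \<rho> l \<omega> \<noteq> None"
    and "\<And>l. l \<ge> 1 \<Longrightarrow> real_analytic_on (slowness n H \<mu> \<rho> l) {\<omega>\<^sub>c l<..}"
    and "\<And>l. l \<ge> 1 \<Longrightarrow> strict_mono_on {\<omega>\<^sub>c l<..} (slowness n H \<mu> \<rho> l)"
    and "\<And>l. l \<ge> 1 \<Longrightarrow> bij_betw (slowness n H \<mu> \<rho> l) {\<omega>\<^sub>c l<..}
                          {1 / speed_inf n \<mu> \<rho> <..< 1 / speed_min n \<mu> \<rho>}"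
  shows "\<forall>l\<ge>1.
      1 / speed_min n \<mu> \<rho> = (SUP \<omega>\<in>{\<omega>\<^sub>c l<..}. slowness n H \<mu> \<rho> l \<omega>) \<and>
      (slowness n H \<mu> \<rho> l \<longlongrightarrow> 1 / speed_min n \<mu> \<rho>) at_top \<and>
      1 / speed_inf n \<mu> \<rho> = (INF \<omega>\<in>{\<omega>\<^sub>c l<..}. slowness n H \<mu> \<rho> l \<omega>) \<and>
      (slowness n H \<mu> \<rho> l \<longlongrightarrow> 1 / speed_inf n \<mu> \<rho>) (at_right (\<omega>\<^sub>c l))"
proof (intro allI impI)
  fix l :: nat assume l: "l \<ge> 1"
  let ?s = "slowness n H \<mu> \<rho> l" and ?a = "1 / speed_inf n \<mu> \<rho>" and ?b = "1 / speed_min n \<mu> \<rho>"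
  have onto: "?s ` {\<omega>\<^sub>c l<..} = {?a<..<?b}"
    using assms(12)[OF l] by (rule bij_betw_imp_surj_on)
  have mono: "mono_on {\<omega>\<^sub>c l<..} ?s"
    using assms(11)[OF l] by (rule strict_mono_on_imp_mono_on)
  have "?a < ?b"
    by (rule less_if_ray_onto_interval[OF onto])
  then have "Sup (?s ` {\<omega>\<^sub>c l<..}) = ?b" and "Inf (?s ` {\<omega>\<^sub>c l<..}) = ?a"
    unfolding onto by (rule cSup_greaterThanLessThan, rule cInf_greaterThanLessThan)
  then show "?b = (SUP \<omega>\<in>{\<omega>\<^sub>c l<..}. ?s \<omega>) \<and> (?s \<longlongrightarrow> ?b) at_top \<and>
      ?a = (INF \<omega>\<in>{\<omega>\<^sub>c l<..}. ?s \<omega>) \<and> (?s \<longlongrightarrow> ?a) (at_right (\<omega>\<^sub>c l))"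
    using tendsto_at_top_if_mono_onto_interval[OF mono onto]
      tendsto_at_right_if_mono_onto_interval[OF mono onto] by simp
qed

end
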